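(* Let $w$ be a weight function on the finite group $G$. Suppose that $G$ acts transitively (on the right) on a set $\Omega$. Let $\alpha \in \Omega$ have point stabiliser $H$. (i) The random walk on $G$ driven by $w$ induces a time-homogeneous Markov chain on $\Omega$ under the quotient map $x \mapsto \alpha x$. (ii) The induced Markov chain on $\Omega$ induces in turn a time-homogeneous Markov chain on the $H$-orbits on $\Omega$, under the quotient map $\beta \mapsto \beta H$, if and only if the probability of a step (in the induced chain on $\Omega$) from $\beta$ to the fixed point $\alpha$ is constant for $\beta$ in the same $H$-orbit; that is, whenever $\beta, \gamma \in \Omega$ lie in the same $H$-orbit, the probability of a step from $\beta$ to $\alpha$ equals the probability of a step from $\gamma$ to $\alpha$.
   Context: A weight function on a finite group $G$ is a function $w : G \to \mathbb{R}_{\ge 0}$ with $w(G) > 0$, where for $S \subseteq G$ we write $w(S) = \sum_{s \in S} w(s)$. The random walk on $G$ driven by $w$ is the time-homogeneous Markov chain on $G$ in which the probability of a transition from $x$ to $y$ is $w(x^{-1}y)/w(G)$ (steps are by right multiplication). "Induces a time-homogeneous Markov chain" under a quotient map on the state space is meant in the strong sense: for every initial distribution of the original chain, the image process is a time-homogeneous Markov chain, with transition probabilities not depending on the initial distribution. *)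

theory Defs
  imports "HOL-Algebra.Group_Action" "HOL-Probability.Probability"
begin

section \<open>Weights and right actions\<close>

definition weight_function :: "('g, 'b) monoid_scheme \<Rightarrow> ('g \<Rightarrow> real) \<Rightarrow> bool"
  where "weight_function G w \<longleftrightarrow>
    (\<forall>g \<in> carrier G. 0 \<le> w g) \<and> (\<Sum>g \<in> carrier G. w g) > 0"

definition random_walk :: "('g, 'b) monoid_scheme \<Rightarrow> ('g \<Rightarrow> real) \<Rightarrow> 'g \<Rightarrow> 'g \<Rightarrow> real"
  where "random_walk G w x y = w (inv\<^bsub>G\<^esub> x \<otimes>\<^bsub>G\<^esub> y) / (\<Sum>g \<in> carrier G. w g)"

text \<open>The locale \<open>group_action\<close> of the library is about left actions. Here \<open>\<phi> g \<beta>\<close> is \<open>\<beta>g\<close>, so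
  \<open>\<phi>\<close> reverses the order of products; \<open>orbit\<close>, \<open>orbits\<close> and \<open>stabilizer\<close> from the library
  do not depend on the side of the action and are used as they are.\<close>

locale right_action = group G for G (structure) +
  fixes \<Omega> :: "'o set" and \<phi> :: "'a \<Rightarrow> 'o \<Rightarrow> 'o"
  assumes act_closed: "\<lbrakk>g \<in> carrier G; \<beta> \<in> \<Omega>\<rbrakk> \<Longrightarrow> \<phi> g \<beta> \<in> \<Omega>"
    and act_one: "\<beta> \<in> \<Omega> \<Longrightarrow> \<phi> \<one> \<beta> = \<beta>"
    and act_mult: "\<lbrakk>g \<in> carrier G; h \<in> carrier G; \<beta> \<in> \<Omega>\<rbrakk> \<Longrightarrow> \<phi> (g \<otimes> h) \<beta> = \<phi> h (\<phi> g \<beta>)"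

locale transitive_right_action = right_action +
  assumes transitive: "\<lbrakk>\<beta> \<in> \<Omega>; \<gamma> \<in> \<Omega>\<rbrakk> \<Longrightarrow> \<exists>g \<in> carrier G. \<phi> g \<beta> = \<gamma>"

section \<open>Markov chains and their images\<close>

definition stochastic_on :: "'s set \<Rightarrow> ('s \<Rightarrow> 's \<Rightarrow> real) \<Rightarrow> bool"
  where "stochastic_on S P \<longleftrightarrow>
    (\<forall>x \<in> S. (\<forall>y \<in> S. 0 \<le> P x y) \<and> (P x has_sum 1) S)"

text \<open>A time-homogeneous Markov chain with discrete state space \<open>S\<close> and transition matrix \<open>P\<close>,
  with no restriction on its initial distribution. Only the values of \<open>P\<close> on \<open>S\<close> matter.\<close>

definition markov_chain ::
    "'w measure \<Rightarrow> 's set \<Rightarrow> ('s \<Rightarrow> 's \<Rightarrow> real) \<Rightarrow> (nat \<Rightarrow> 'w \<Rightarrow> 's) \<Rightarrow> bool"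
  where "markov_chain M S P X \<longleftrightarrow>
    prob_space M \<and> stochastic_on S P \<and> (\<forall>n. X n \<in> M \<rightarrow>\<^sub>M count_space S) \<and>
    (\<forall>n x. (\<forall>i \<le> Suc n. x i \<in> S) \<longrightarrow> \<P>(\<omega> in M. \<forall>i \<le> n. X i \<omega> = x i) > 0 \<longrightarrow>
       \<P>(\<omega> in M. X (Suc n) \<omega> = x (Suc n) \<bar> \<forall>i \<le> n. X i \<omega> = x i) = P (x n) (x (Suc n)))"

text \<open>The chain on \<open>S\<close> with transition matrix \<open>P\<close> induces one on \<open>T\<close> with transition matrix \<open>Q\<close>
  under \<open>f\<close>. All initial distributions of \<open>X\<close> are covered, and \<open>Q\<close> does not depend on them.
  A quantifier over all types of sample spaces is not available in HOL; the type \<open>nat \<Rightarrow> 's\<close> of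
  trajectories is large enough, since every \<open>'s\<close>-valued process has the same law as the coordinate
  process on its path space.\<close>

definition induces_chain ::
    "'s set \<Rightarrow> ('s \<Rightarrow> 's \<Rightarrow> real) \<Rightarrow> ('s \<Rightarrow> 't) \<Rightarrow> 't set \<Rightarrow> ('t \<Rightarrow> 't \<Rightarrow> real) \<Rightarrow> bool"
  where "induces_chain S P f T Q \<longleftrightarrow>
    stochastic_on T Q \<and>
    (\<forall>(M :: (nat \<Rightarrow> 's) measure) X. markov_chain M S P X \<longrightarrow>
       markov_chain M T Q (\<lambda>n \<omega>. f (X n \<omega>)))"

end

theory Submission
  imports Defs
begin

text \<open>The image of a finite chain under f is Markov for all initial distributions, with one
  transition matrix, exactly when the probability of a step from x into each fibre of f depends only
  on f x (\<open>lumpable_iff\<close>). If it does, the law of an image path is a sum over its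
  lifts, in which the last step is a common factor (\<open>markov_chain_image\<close>). Conversely,
  a chain started at x shows that the step probability of the image out of f x is that of x into the
  fibre (\<open>induces_chain_imp_lump\<close>). This needs a chain from each state: on G it is
  built from independent increments (\<open>random_walk_exists\<close>), and on \<Omega> it is an
  image of such a walk.

  For (i), put y = xg: a step from x into the fibre over \<gamma> has probability w({g. (\<alpha>x)g
  = \<gamma>})/w(G), which depends only on \<alpha>x (\<open>sum_random_walk_fibre\<close>). So the
  matrix on \<Omega> must be \<open>step_prob\<close>.

  For (ii), {\<alpha>} is itself an H-orbit, so lumpability contains the stated condition.
  Conversely, for an H-orbit B let T = {g. \<beta>g in B}, a union of left cosets gH. Steps into B
  from \<beta> and from \<beta>h have weights w(T) and w(h^-1 T). Now w(gH)/w(G) is the probability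
  of a step from \<alpha>g^-1 to \<alpha>, and translating the coset by h^-1 replaces \<alpha>g^-1
  by \<alpha>g^-1 h, a point of the same H-orbit. So the condition equates the weights coset by
  coset (\<open>step_prob_lumpable\<close>).\<close>

section \<open>Images of finite Markov chains and lumpability\<close>

lemma markov_chainD:
  assumes "markov_chain M S P X"
  shows "prob_space M" "stochastic_on S P" "X n \<in> M \<rightarrow>\<^sub>M count_space S"
    and "\<omega> \<in> space M \<Longrightarrow> X n \<omega> \<in> S"
    and "Measurable.pred M (\<lambda>\<omega>. p (X n \<omega>))"
proof -
  show "prob_space M" "stochastic_on S P" and X: "X n \<in> M \<rightarrow>\<^sub>M count_space S"
    using assms by (simp_all add: markov_chain_def)
  show "\<omega> \<in> space M \<Longrightarrow> X n \<omega> \<in> S"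
    using measurable_space[OF X] by simp
  show "Measurable.pred M (\<lambda>\<omega>. p (X n \<omega>))"
    using measurable_compose[OF X, of p "count_space UNIV"] by simp
qed

text \<open>The Markov property with the denominator cleared. It also covers a past of probability
  0, where both sides vanish, and so can be summed over paths without case distinctions.\<close>

lemma markov_chain_step:
  assumes mc: "markov_chain M S P X" and x: "\<And>i. i \<le> n \<Longrightarrow> x i \<in> S" and y: "y \<in> S"
  shows "\<P>(\<omega> in M. (\<forall>i\<le>n. X i \<omega> = x i) \<and> X (Suc n) \<omega> = y)
    = \<P>(\<omega> in M. \<forall>i\<le>n. X i \<omega> = x i) * P (x n) y" (is "?L = ?E * _")
proof -
  interpret prob_space M by (rule markov_chainD(1)[OF mc])
  note [measurable] = markov_chainD(5)[OF mc]
  have le: "?L \<le> ?E" by (intro finite_measure_mono) (auto intro: sets.sets_Collect)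
  show ?thesis
  proof (cases "?E > 0")
    case True
    let ?x = "x(Suc n := y)"
    have "\<P>(\<omega> in M. X (Suc n) \<omega> = ?x (Suc n) \<bar> \<forall>i\<le>n. X i \<omega> = ?x i) = P (?x n) (?x (Suc n))"
      using mc unfolding markov_chain_def
      by (elim conjE allE[of _ n] allE[of _ ?x] impE) (use x y True in \<open>auto simp: le_Suc_eq\<close>)
    then have "\<P>(\<omega> in M. X (Suc n) \<omega> = y \<bar> \<forall>i\<le>n. X i \<omega> = x i) = P (x n) y"
      by simp
    then show ?thesis
      using True by (auto simp: cond_prob_def divide_eq_eq conj_commute mult.commute)
  next
    case False
    then have "?E = 0" using measure_nonneg[of M] by (simp add: not_less order_antisym)
    moreover from this have "?L = 0" using le by (simp only: measure_le_0_iff)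
    ultimately show ?thesis by simp
  qed
qed

lemma markov_chainI:
  assumes "prob_space M" "stochastic_on S P" "\<And>n. X n \<in> M \<rightarrow>\<^sub>M count_space S"
    and step: "\<And>n x. (\<And>i. i \<le> Suc n \<Longrightarrow> x i \<in> S) \<Longrightarrow>
      \<P>(\<omega> in M. (\<forall>i\<le>n. X i \<omega> = x i) \<and> X (Suc n) \<omega> = x (Suc n))
      = \<P>(\<omega> in M. \<forall>i\<le>n. X i \<omega> = x i) * P (x n) (x (Suc n))"
  shows "markov_chain M S P X"
  unfolding markov_chain_def
proof (intro conjI allI impI)
  fix n x assume x: "\<forall>i\<le>Suc n. x i \<in> S" and pos: "\<P>(\<omega> in M. \<forall>i\<le>n. X i \<omega> = x i) > 0"
  show "\<P>(\<omega> in M. X (Suc n) \<omega> = x (Suc n) \<bar> \<forall>i\<le>n. X i \<omega> = x i) = P (x n) (x (Suc n))"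
    using step[of n x] x pos by (simp add: cond_prob_def conj_commute)
qed (use assms in auto)

text \<open>The event that the image follows t is the disjoint union, over the finitely many lifts a
  of t, of the events that X follows a. Each lift ends in the fibre over \<open>t n\<close>, so by
  \<open>lump\<close> the sum over the next state is the same factor
  \<open>Q (t n) (t (Suc n))\<close> for all of them.\<close>

lemma markov_chain_image:
  assumes mc: "markov_chain M S P X" and fin: "finite S" and f: "f \<in> S \<rightarrow> T"
    and Q: "stochastic_on T Q"
    and lump: "\<And>x t. x \<in> S \<Longrightarrow> t \<in> T \<Longrightarrow> Q (f x) t = (\<Sum>y | y \<in> S \<and> f y = t. P x y)"
  shows "markov_chain M T Q (\<lambda>n \<omega>. f (X n \<omega>))"
proof (rule markov_chainI)
  interpret prob_space M by (rule markov_chainD(1)[OF mc])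
  note [measurable] = markov_chainD(5)[OF mc]
  note XS = markov_chainD(4)[OF mc]
  show "(\<lambda>\<omega>. f (X n \<omega>)) \<in> M \<rightarrow>\<^sub>M count_space T" for n
    by (rule measurable_compose[OF markov_chainD(3)[OF mc]]) (use f in auto)
  fix n t assume t: "\<And>i. i \<le> Suc n \<Longrightarrow> t i \<in> T"
  define A where "A = Pi\<^sub>E {..n} (\<lambda>i. {x \<in> S. f x = t i})"
  define B where "B = {y \<in> S. f y = t (Suc n)}"
  let ?p = "\<lambda>a \<omega>. \<forall>i\<le>n. X i \<omega> = a i"
  have finA: "finite A" and finB: "finite B"
    unfolding A_def B_def using fin by (auto intro!: finite_PiE)
  have A: "a i \<in> S" "f (a i) = t i" if "a \<in> A" "i \<le> n" for a i
    using that by (auto simp: A_def PiE_iff)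
  \<comment> \<open>The unique lift is the trajectory itself cut off after time n; functions in
    \<open>A\<close> are extensional, so agreement up to n determines them.\<close>
  have ex1: "\<exists>!a\<in>A. ?p a \<omega>" if "\<omega> \<in> space M" "\<forall>i\<le>n. f (X i \<omega>) = t i" for \<omega>
  proof (rule ex1I)
    show "restrict (\<lambda>i. X i \<omega>) {..n} \<in> A \<and> ?p (restrict (\<lambda>i. X i \<omega>) {..n}) \<omega>"
      using that XS by (auto simp: A_def)
    show "a = restrict (\<lambda>i. X i \<omega>) {..n}" if "a \<in> A \<and> ?p a \<omega>" for a
      using that by (auto simp: A_def PiE_iff extensional_def)
  qed
  have "\<P>(\<omega> in M. \<forall>i\<le>n. f (X i \<omega>) = t i) = (\<Sum>a\<in>A. \<P>(\<omega> in M. ?p a \<omega>))"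
    by (rule prob_sum[OF finA]) (use A ex1 in auto)
  then have past: "\<P>(\<omega> in M. \<forall>i\<le>n. f (X i \<omega>) = t i) * q
      = (\<Sum>a\<in>A. \<P>(\<omega> in M. ?p a \<omega>) * q)" for q
    by (simp add: sum_distrib_right)
  have "\<P>(\<omega> in M. (\<forall>i\<le>n. f (X i \<omega>) = t i) \<and> f (X (Suc n) \<omega>) = t (Suc n))
      = (\<Sum>z\<in>A\<times>B. \<P>(\<omega> in M. ?p (fst z) \<omega> \<and> X (Suc n) \<omega> = snd z))"
  proof (rule prob_sum)
    show "AE \<omega> in M. (\<forall>z\<in>A \<times> B. ?p (fst z) \<omega> \<and> X (Suc n) \<omega> = snd z \<longrightarrow>
        (\<forall>i\<le>n. f (X i \<omega>) = t i) \<and> f (X (Suc n) \<omega>) = t (Suc n)) \<and>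
      ((\<forall>i\<le>n. f (X i \<omega>) = t i) \<and> f (X (Suc n) \<omega>) = t (Suc n) \<longrightarrow>
        (\<exists>!z. z \<in> A \<times> B \<and> ?p (fst z) \<omega> \<and> X (Suc n) \<omega> = snd z))"
    proof (intro AE_I2 conjI impI)
      fix \<omega> assume \<omega>: "\<omega> \<in> space M"
      show "\<forall>z\<in>A \<times> B. ?p (fst z) \<omega> \<and> X (Suc n) \<omega> = snd z \<longrightarrow>
        (\<forall>i\<le>n. f (X i \<omega>) = t i) \<and> f (X (Suc n) \<omega>) = t (Suc n)"
        using A by (auto simp: B_def)
      assume *: "(\<forall>i\<le>n. f (X i \<omega>) = t i) \<and> f (X (Suc n) \<omega>) = t (Suc n)"
      then have "X (Suc n) \<omega> \<in> B" using XS \<omega> by (auto simp: B_def)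
      with ex1[OF \<omega>] * show "\<exists>!z. z \<in> A \<times> B \<and> ?p (fst z) \<omega> \<and> X (Suc n) \<omega> = snd z"
        by (auto simp: Ex1_def)
    qed
  qed (use finA finB in auto)
  also have "\<dots> = (\<Sum>a\<in>A. \<Sum>y\<in>B. \<P>(\<omega> in M. ?p a \<omega> \<and> X (Suc n) \<omega> = y))"
    by (simp add: sum.cartesian_product case_prod_beta)
  also have "\<dots> = (\<Sum>a\<in>A. \<Sum>y\<in>B. \<P>(\<omega> in M. ?p a \<omega>) * P (a n) y)"
    by (intro sum.cong refl markov_chain_step[OF mc]) (use A in \<open>auto simp: B_def\<close>)
  also have "\<dots> = (\<Sum>a\<in>A. \<P>(\<omega> in M. ?p a \<omega>) * Q (t n) (t (Suc n)))"
  proof (intro sum.cong refl)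
    fix a assume a: "a \<in> A"
    then show "(\<Sum>y\<in>B. \<P>(\<omega> in M. ?p a \<omega>) * P (a n) y)
        = \<P>(\<omega> in M. ?p a \<omega>) * Q (t n) (t (Suc n))"
      using lump[of "a n" "t (Suc n)"] A[of a n] t by (simp add: B_def sum_distrib_left)
  qed
  finally show "\<P>(\<omega> in M. (\<forall>i\<le>n. f (X i \<omega>) = t i) \<and> f (X (Suc n) \<omega>) = t (Suc n))
      = \<P>(\<omega> in M. \<forall>i\<le>n. f (X i \<omega>) = t i) * Q (t n) (t (Suc n))"
    unfolding past .
qed (use Q mc in \<open>auto simp: markov_chain_def\<close>)

text \<open>When X starts at x almost surely, the events that X and its image start at x and f x
  both have probability 1, so the probability of the first step into the fibre over t can be
  computed in either chain.\<close>

lemma induces_chain_imp_lump: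
  fixes M :: "(nat \<Rightarrow> 's) measure" and S :: "'s set"
  assumes ind: "induces_chain S P f T Q" and fin: "finite S"
    and mc: "markov_chain M S P X" and start: "\<P>(\<omega> in M. X 0 \<omega> = x) = 1"
    and x: "x \<in> S" and t: "t \<in> T"
  shows "Q (f x) t = (\<Sum>y | y \<in> S \<and> f y = t. P x y)"
proof -
  interpret prob_space M by (rule markov_chainD(1)[OF mc])
  note [measurable] = markov_chainD(5)[OF mc]
  have mcf: "markov_chain M T Q (\<lambda>n \<omega>. f (X n \<omega>))"
    using ind mc by (simp add: induces_chain_def)
  have AEx: "AE \<omega> in M. X 0 \<omega> = x"
    using start by (subst (asm) prob_Collect_eq_1) auto
  \<comment> \<open>An event of probability 1 contains a sample point, and the image chain takes the
    value f x there; this puts f x into \<open>T\<close>.\<close>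
  have "prob (space M) = 1" by (rule prob_space)
  then obtain \<omega> where \<omega>: "\<omega> \<in> space M" "X 0 \<omega> = x"
    using start by (metis (mono_tags, lifting) empty_Collect_eq measure_empty zero_neq_one)
  then have fx: "f x \<in> T" using markov_chainD(4)[OF mcf, of \<omega> 0] by simp
  have "\<P>(\<omega> in M. f (X 0 \<omega>) = f x) = 1"
    using AEx by (subst prob_Collect_eq_1) auto
  then have "Q (f x) t = \<P>(\<omega> in M. f (X 0 \<omega>) = f x \<and> f (X 1 \<omega>) = t)"
    using markov_chain_step[OF mcf, of 0 "\<lambda>_. f x" t] fx t by simp
  also have "\<dots> = (\<Sum>y | y \<in> S \<and> f y = t. \<P>(\<omega> in M. X 0 \<omega> = x \<and> X 1 \<omega> = y))"
    using AEx AE_space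
    by (intro prob_sum) (use fin markov_chainD(4)[OF mc] in auto)
  also have "\<dots> = (\<Sum>y | y \<in> S \<and> f y = t. P x y)"
    using markov_chain_step[OF mc, of 0 "\<lambda>_. x"] x start by (intro sum.cong) auto
  finally show ?thesis .
qed

text \<open>The strong lumpability criterion of Kemeny and Snell; necessity only needs the chains
  started at a single state.\<close>

lemma lumpable_iff:
  fixes S :: "'s set"
  assumes fin: "finite S" and P: "stochastic_on S P" and T: "f ` S = T"
    and ex: "\<And>x. x \<in> S \<Longrightarrow>
      \<exists>(M :: (nat \<Rightarrow> 's) measure) X. markov_chain M S P X \<and> \<P>(\<omega> in M. X 0 \<omega> = x) = 1"
  shows "(\<exists>Q. induces_chain S P f T Q) \<longleftrightarrow>
    (\<forall>x\<in>S. \<forall>y\<in>S. f x = f y \<longrightarrow>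
      (\<forall>t\<in>T. (\<Sum>z | z \<in> S \<and> f z = t. P x z) = (\<Sum>z | z \<in> S \<and> f z = t. P y z)))"
    (is "_ \<longleftrightarrow> ?R")
proof
  assume "\<exists>Q. induces_chain S P f T Q"
  then obtain Q where Q: "induces_chain S P f T Q" ..
  have "Q (f x) t = (\<Sum>z | z \<in> S \<and> f z = t. P x z)" if "x \<in> S" "t \<in> T" for x t
    using ex[OF that(1)] induces_chain_imp_lump[OF Q fin _ _ that] by blast
  then show ?R by metis
next
  assume R: ?R
  \<comment> \<open>The row at s is read off from a chosen point of the fibre over s;
    \<open>?R\<close> makes the choice immaterial.\<close>
  define Q where "Q s t = (\<Sum>z | z \<in> S \<and> f z = t. P (SOME x. x \<in> S \<and> f x = s) z)" for s t
  have Q: "Q (f x) t = (\<Sum>z | z \<in> S \<and> f z = t. P x z)" if "x \<in> S" "t \<in> T" for x t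
  proof -
    have "(SOME y. y \<in> S \<and> f y = f x) \<in> S \<and> f (SOME y. y \<in> S \<and> f y = f x) = f x"
      by (rule someI[of _ x]) (use that in simp)
    then show ?thesis unfolding Q_def using R that by blast
  qed
  have "finite T" using fin T by blast
  have "stochastic_on T Q"
    unfolding stochastic_on_def
  proof (intro ballI conjI)
    fix s assume "s \<in> T"
    then obtain x where x: "x \<in> S" "s = f x" using T by blast
    show "0 \<le> Q s t" if "t \<in> T" for t
      using P x that by (auto simp: Q stochastic_on_def intro: sum_nonneg)
    have "(\<Sum>t\<in>T. Q s t) = (\<Sum>t\<in>T. \<Sum>z | z \<in> S \<and> f z = t. P x z)"
      using x by (simp add: Q)
    also have "\<dots> = (\<Sum>z\<in>S. P x z)"
      using T by (intro sum.group fin \<open>finite T\<close>) auto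
    also have "\<dots> = 1"
      using P x by (intro has_sum_unique[OF has_sum_finite[OF fin]]) (auto simp: stochastic_on_def)
    finally show "(Q s has_sum 1) T"
      using has_sum_finite[OF \<open>finite T\<close>, of "Q s"] by simp
  qed
  then have "induces_chain S P f T Q"
    unfolding induces_chain_def
    using markov_chain_image[where S = S and T = T and f = f and P = P and Q = Q] fin Q T by blast
  then show "\<exists>Q. induces_chain S P f T Q" by blast
qed

text \<open>Moves a chain to its path space, the only sample space that \<^const>\<open>induces_chain\<close>
  quantifies over.\<close>

lemma markov_chain_path_space:
  assumes mc: "markov_chain M S P X"
  shows "\<exists>M' :: (nat \<Rightarrow> 's) measure. markov_chain M' S P (\<lambda>n \<omega>. \<omega> n) \<and>
    \<P>(\<omega> in M'. \<omega> 0 = x) = \<P>(\<omega> in M. X 0 \<omega> = x)"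
proof (intro exI conjI)
  interpret prob_space M by (rule markov_chainD(1)[OF mc])
  define N where "N = Pi\<^sub>M UNIV (\<lambda>_::nat. count_space S)"
  define F where "F = (\<lambda>\<omega> n. X n \<omega>)"
  have F: "F \<in> M \<rightarrow>\<^sub>M N"
    unfolding N_def F_def
    using markov_chainD(3)[OF mc] markov_chainD(4)[OF mc] by (intro measurable_PiM_single') auto
  have coord: "(\<lambda>\<omega>. \<omega> n) \<in> N \<rightarrow>\<^sub>M count_space S" for n
    unfolding N_def by simp
  have [measurable]: "Measurable.pred N (\<lambda>\<omega>. p (\<omega> n))" for p n
    using measurable_compose[OF coord, of p "count_space UNIV"] by simp
  have eq: "\<P>(\<omega> in distr M N F. p \<omega>) = \<P>(\<omega> in M. p (F \<omega>))" if "Measurable.pred N p" for p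
    using that F measurable_space[OF F]
    by (subst measure_distr) (auto intro!: arg_cong[where f = prob])
  show "\<P>(\<omega> in distr M N F. \<omega> 0 = x) = \<P>(\<omega> in M. X 0 \<omega> = x)"
    by (subst eq) (auto simp: F_def)
  show "markov_chain (distr M N F) S P (\<lambda>n \<omega>. \<omega> n)"
  proof (rule markov_chainI)
    show "prob_space (distr M N F)" by (rule prob_space_distr[OF F])
    show "stochastic_on S P" by (rule markov_chainD(2)[OF mc])
    show "(\<lambda>\<omega>. \<omega> n) \<in> distr M N F \<rightarrow>\<^sub>M count_space S" for n using coord by simp
    fix n and x :: "nat \<Rightarrow> 's" assume x: "\<And>i. i \<le> Suc n \<Longrightarrow> x i \<in> S"
    show "\<P>(\<omega> in distr M N F. (\<forall>i\<le>n. \<omega> i = x i) \<and> \<omega> (Suc n) = x (Suc n))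
      = \<P>(\<omega> in distr M N F. \<forall>i\<le>n. \<omega> i = x i) * P (x n) (x (Suc n))"
      using markov_chain_step[OF mc, of n x "x (Suc n)"] x
      by (subst (1 2) eq) (auto simp: F_def)
  qed
qed


section \<open>Weights and random walks on a finite group\<close>

context group
begin

lemma sum_left_translate:
  fixes w :: "'a \<Rightarrow> real"
  assumes x: "x \<in> carrier G"
  shows "(\<Sum>y | y \<in> carrier G \<and> p y. w (inv x \<otimes> y)) = (\<Sum>g | g \<in> carrier G \<and> p (x \<otimes> g). w g)"
  by (rule sum.reindex_bij_witness[of _ "\<lambda>g. x \<otimes> g" "\<lambda>y. inv x \<otimes> y"])
    (use x in \<open>auto simp: m_assoc[symmetric]\<close>)

text \<open>Right translation by each k in \<open>H\<close> permutes \<open>T\<close>, so every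
  inner sum over \<open>T\<close> equals \<open>sum w T\<close>. Averaging over \<open>H\<close> in
  this way replaces a choice of coset representatives.\<close>

lemma sum_coset_average:
  fixes w :: "'a \<Rightarrow> real"
  assumes H: "subgroup H G" and T: "T \<subseteq> carrier G"
    and inv: "\<And>g k. g \<in> T \<Longrightarrow> k \<in> H \<Longrightarrow> g \<otimes> k \<in> T"
  shows "real (card H) * sum w T = (\<Sum>g\<in>T. \<Sum>k\<in>H. w (g \<otimes> k))"
proof -
  have "(\<Sum>g\<in>T. w (g \<otimes> k)) = sum w T" if k: "k \<in> H" for k
    by (rule sum.reindex_bij_witness[of _ "\<lambda>g. g \<otimes> inv k" "\<lambda>g. g \<otimes> k"])
      (use k T inv subgroup.m_inv_closed[OF H] subgroup.mem_carrier[OF H]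
        in \<open>auto simp: m_assoc subset_iff\<close>)
  then show ?thesis by (subst sum.swap) simp
qed

text \<open>Both sides, multiplied by |H|, become sums over g in \<open>T\<close> of weights of the
  cosets hgH and gH, which agree by \<open>eq\<close>.\<close>

lemma sum_left_translate_eq:
  fixes w :: "'a \<Rightarrow> real"
  assumes fin: "finite (carrier G)" and H: "subgroup H G" and T: "T \<subseteq> carrier G"
    and inv: "\<And>g k. g \<in> T \<Longrightarrow> k \<in> H \<Longrightarrow> g \<otimes> k \<in> T"
    and h: "h \<in> carrier G"
    and eq: "\<And>g. g \<in> T \<Longrightarrow> (\<Sum>k\<in>H. w (h \<otimes> g \<otimes> k)) = (\<Sum>k\<in>H. w (g \<otimes> k))"
  shows "(\<Sum>g\<in>T. w (h \<otimes> g)) = sum w T"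
proof -
  have "real (card H) * (\<Sum>g\<in>T. w (h \<otimes> g)) = (\<Sum>g\<in>T. \<Sum>k\<in>H. w (h \<otimes> (g \<otimes> k)))"
    using sum_coset_average[OF H T inv, of "\<lambda>g. w (h \<otimes> g)"] by simp
  also have "\<dots> = (\<Sum>g\<in>T. \<Sum>k\<in>H. w (h \<otimes> g \<otimes> k))"
    using T h subgroup.mem_carrier[OF H]
    by (intro sum.cong refl arg_cong[where f = w]) (auto simp: m_assoc)
  also have "\<dots> = real (card H) * sum w T"
    using sum_coset_average[OF H T inv, of w] eq by simp
  finally show ?thesis
    using subgroup.finite_imp_card_positive[OF H fin] by simp
qed

lemma stochastic_on_random_walk:
  assumes fin: "finite (carrier G)" and w: "weight_function G w"
  shows "stochastic_on (carrier G) (random_walk G w)"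
  unfolding stochastic_on_def
proof (intro ballI conjI)
  fix x assume x: "x \<in> carrier G"
  show "0 \<le> random_walk G w x y" if "y \<in> carrier G" for y
    using w x that by (simp add: weight_function_def random_walk_def)
  have "(\<Sum>y\<in>carrier G. random_walk G w x y) = 1"
    using sum_left_translate[OF x, of w "\<lambda>_. True"] w
    by (simp add: random_walk_def weight_function_def flip: sum_divide_distrib)
  then show "(random_walk G w x has_sum 1) (carrier G)"
    using has_sum_finite[OF fin, of "random_walk G w x"] by simp
qed

primrec walk :: "'a \<Rightarrow> nat \<Rightarrow> (nat \<Rightarrow> 'a) \<Rightarrow> 'a"
  where "walk x 0 \<omega> = x"
  | "walk x (Suc n) \<omega> = walk x n \<omega> \<otimes> \<omega> n"

text \<open>Path and increments determine each other, so a path event is a cylinder event for the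
  increments.\<close>

lemma walk_eq_iff:
  assumes "\<And>i. \<omega> i \<in> carrier G" and "\<And>i. i \<le> n \<Longrightarrow> y i \<in> carrier G"
  shows "(\<forall>i\<le>n. walk x i \<omega> = y i) \<longleftrightarrow> y 0 = x \<and> (\<forall>i<n. \<omega> i = inv (y i) \<otimes> y (Suc i))"
  using assms(2)
proof (induction n)
  case (Suc n)
  have "y n \<otimes> \<omega> n = y (Suc n) \<longleftrightarrow> \<omega> n = inv (y n) \<otimes> y (Suc n)"
    using assms(1) Suc.prems[of n] Suc.prems[of "Suc n"] inv_solve_left by auto
  then show ?case
    using Suc by (auto simp: le_Suc_eq less_Suc_eq)
qed auto

text \<open>The sample space is the infinite product of the law w/w(G), whose coordinates are the
  increments. A path then has the product of its step probabilities as its probability.\<close>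

lemma random_walk_exists:
  assumes fin: "finite (carrier G)" and w: "weight_function G w" and x: "x \<in> carrier G"
  shows "\<exists>(M :: (nat \<Rightarrow> 'a) measure) X. markov_chain M (carrier G) (random_walk G w) X \<and>
    \<P>(\<omega> in M. X 0 \<omega> = x) = 1"
proof (intro exI conjI)
  define W where "W = (\<Sum>g\<in>carrier G. w g)"
  define D where "D = point_measure (carrier G) (\<lambda>g. ennreal (w g / W))"
  define N where "N = Pi\<^sub>M UNIV (\<lambda>_::nat. D)"
  have W: "W > 0" and w0: "\<And>g. g \<in> carrier G \<Longrightarrow> 0 \<le> w g"
    using w by (auto simp: W_def weight_function_def)
  interpret D: prob_space D
    unfolding D_def
  proof (rule prob_space_point_measure[OF fin])
    show "(\<Sum>g\<in>carrier G. ennreal (w g / W)) = 1"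
      using W w0 by (subst sum_ennreal) (auto simp: W_def simp flip: sum_divide_distrib)
  qed simp
  interpret product_prob_space "\<lambda>_::nat. D" UNIV ..
  interpret N: prob_space N unfolding N_def by (rule prob_space_axioms)
  have sets_D: "sets D = Pow (carrier G)" and space_D: "space D = carrier G"
    by (simp_all add: D_def space_point_measure sets_point_measure)
  have space_N: "\<omega> i \<in> carrier G" if "\<omega> \<in> space N" for \<omega> i
    using that by (auto simp: N_def space_PiM space_D)
  have D_singleton: "measure D {g} = w g / W" if "g \<in> carrier G" for g
    using that fin W w0
    by (simp add: measure_def D_def emeasure_point_measure_finite)
  have cylinder: "\<P>(\<omega> in N. \<forall>i<n. \<omega> i = g i) = (\<Prod>i<n. w (g i) / W)"
    if g: "\<And>i. i < n \<Longrightarrow> g i \<in> carrier G" for n g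
  proof -
    have "{\<omega> \<in> space N. \<forall>i<n. \<omega> i = g i}
        = prod_emb UNIV (\<lambda>_. D) {..<n} (Pi\<^sub>E {..<n} (\<lambda>i. {g i}))"
      by (auto simp: prod_emb_def N_def space_PiM PiE_iff)
    also have "measure N \<dots> = (\<Prod>i<n. measure D {g i})"
      unfolding N_def by (rule measure_PiM_emb) (use g in \<open>auto simp: sets_D\<close>)
    finally show ?thesis using g by (simp add: D_singleton)
  qed
  show "\<P>(\<omega> in N. walk x 0 \<omega> = x) = 1" by (simp add: N.prob_space)
  show "markov_chain N (carrier G) (random_walk G w) (walk x)"
  proof (rule markov_chainI)
    show "walk x n \<in> N \<rightarrow>\<^sub>M count_space (carrier G)" for n
    proof (induction n)
      case (Suc n)
      \<comment> \<open>The position at time n takes finitely many values, so measurability of the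
        next position reduces to that with a fixed position b.\<close>
      have mult: "(\<lambda>\<omega>. b \<otimes> \<omega> n) \<in> N \<rightarrow>\<^sub>M count_space (carrier G)" if "b \<in> carrier G" for b
      proof (rule measurable_compose[of "\<lambda>\<omega>. \<omega> n" N D])
        show "(\<lambda>\<omega>. \<omega> n) \<in> N \<rightarrow>\<^sub>M D" unfolding N_def by simp
        show "(\<otimes>) b \<in> D \<rightarrow>\<^sub>M count_space (carrier G)"
          using that by (auto simp: measurable_def sets_D space_D)
      qed
      show ?case
        using measurable_compose_countable'[OF mult Suc countable_finite[OF fin]] by simp
    qed (use x in simp)
    fix n y assume y: "\<And>i. i \<le> Suc n \<Longrightarrow> y i \<in> carrier G"
    let ?g = "\<lambda>i. inv (y i) \<otimes> y (Suc i)"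
    \<comment> \<open>Used for m = n and m = \<open>Suc n\<close>; the two products differ by one
      factor, the transition probability.\<close>
    have path: "\<P>(\<omega> in N. \<forall>i\<le>m. walk x i \<omega> = y i)
        = (if y 0 = x then \<Prod>i<m. w (?g i) / W else 0)" if m: "m \<le> Suc n" for m
    proof -
      have "{\<omega> \<in> space N. \<forall>i\<le>m. walk x i \<omega> = y i}
          = (if y 0 = x then {\<omega> \<in> space N. \<forall>i<m. \<omega> i = ?g i} else {})"
        using walk_eq_iff[of _ m y x] space_N y m by auto
      then show ?thesis using cylinder[of m ?g] y m by auto
    qed
    have "\<P>(\<omega> in N. (\<forall>i\<le>n. walk x i \<omega> = y i) \<and> walk x (Suc n) \<omega> = y (Suc n))
        = \<P>(\<omega> in N. \<forall>i\<le>Suc n. walk x i \<omega> = y i)"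
      by (intro arg_cong[where f = "measure N"]) (auto simp: le_Suc_eq simp del: walk.simps)
    then show "\<P>(\<omega> in N. (\<forall>i\<le>n. walk x i \<omega> = y i) \<and> walk x (Suc n) \<omega> = y (Suc n))
        = \<P>(\<omega> in N. \<forall>i\<le>n. walk x i \<omega> = y i) * random_walk G w (y n) (y (Suc n))"
      by (simp add: path random_walk_def W_def del: walk.simps)
  qed (rule N.prob_space_axioms stochastic_on_random_walk[OF fin w])+
qed

end

section \<open>Step probabilities between points of a right action\<close>

context right_action
begin

lemma subgroup_stabilizer:
  assumes "\<alpha> \<in> \<Omega>"
  shows "subgroup (stabilizer G \<phi> \<alpha>) G"
proof (rule subgroupI)
  show "inv h \<in> stabilizer G \<phi> \<alpha>" if "h \<in> stabilizer G \<phi> \<alpha>" for h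
    using that act_mult[of h "inv h" \<alpha>] act_one assms by (auto simp: stabilizer_def)
qed (use assms act_one act_mult in \<open>auto simp: stabilizer_def\<close>)

lemma orbit_subgroup_act:
  assumes H: "subgroup H G" and k: "k \<in> H" and \<beta>: "\<beta> \<in> \<Omega>"
  shows "orbit (G\<lparr>carrier := H\<rparr>) \<phi> (\<phi> k \<beta>) = orbit (G\<lparr>carrier := H\<rparr>) \<phi> \<beta>"
proof -
  interpret H: subgroup H G by (rule H)
  have kG: "k \<in> carrier G" using k by simp
  have "(\<lambda>g. \<phi> g (\<phi> k \<beta>)) ` H = (\<lambda>g. \<phi> g \<beta>) ` H"
  proof (intro equalityI image_subsetI)
    fix g assume g: "g \<in> H"
    show "\<phi> g (\<phi> k \<beta>) \<in> (\<lambda>g. \<phi> g \<beta>) ` H"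
      by (rule image_eqI[of _ _ "k \<otimes> g"]) (use g k \<beta> in \<open>auto simp: act_mult\<close>)
    show "\<phi> g \<beta> \<in> (\<lambda>g. \<phi> g (\<phi> k \<beta>)) ` H"
      by (rule image_eqI[of _ _ "inv k \<otimes> g"])
        (use g k kG \<beta> in \<open>auto simp: act_mult[symmetric] m_assoc[symmetric]\<close>)
  qed
  then show ?thesis by (simp add: orbit_def image_def Bex_def conj_commute)
qed

lemma orbit_self:
  assumes "subgroup H G" and "\<beta> \<in> \<Omega>"
  shows "\<beta> \<in> orbit (G\<lparr>carrier := H\<rparr>) \<phi> \<beta>"
  using act_one[OF assms(2)] subgroup.one_closed[OF assms(1)] unfolding orbit_def by force

lemma orbit_subgroup_eqD:
  assumes "subgroup H G" and "\<gamma> \<in> \<Omega>"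
    and "orbit (G\<lparr>carrier := H\<rparr>) \<phi> \<beta> = orbit (G\<lparr>carrier := H\<rparr>) \<phi> \<gamma>"
  obtains h where "h \<in> H" "\<gamma> = \<phi> h \<beta>"
  using orbit_self[OF assms(1,2)] assms(3) unfolding orbit_def by auto

text \<open>The candidate for the transition matrix of the induced chain on \<Omega>; it makes sense
  before such a chain is known to exist.\<close>

definition step_prob :: "('a \<Rightarrow> real) \<Rightarrow> 'o \<Rightarrow> 'o \<Rightarrow> real"
  where "step_prob w \<beta> \<gamma> = (\<Sum>g | g \<in> carrier G \<and> \<phi> g \<beta> = \<gamma>. w g) / (\<Sum>g\<in>carrier G. w g)"

lemma sum_random_walk_fibre:
  assumes x: "x \<in> carrier G" and \<alpha>: "\<alpha> \<in> \<Omega>"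
  shows "(\<Sum>y | y \<in> carrier G \<and> \<phi> y \<alpha> = \<gamma>. random_walk G w x y) = step_prob w (\<phi> x \<alpha>) \<gamma>"
proof -
  have "{g. g \<in> carrier G \<and> \<phi> (x \<otimes> g) \<alpha> = \<gamma>} = {g. g \<in> carrier G \<and> \<phi> g (\<phi> x \<alpha>) = \<gamma>}"
    using assms by (auto simp: act_mult)
  then show ?thesis
    using sum_left_translate[OF x, of w "\<lambda>y. \<phi> y \<alpha> = \<gamma>"]
    by (simp add: random_walk_def step_prob_def flip: sum_divide_distrib)
qed

text \<open>The elements taking \<beta> into the fibre over \<open>B\<close> are partitioned by the
  point they take it to.\<close>

lemma sum_step_prob:
  assumes fin: "finite (carrier G)" "finite \<Omega>" and \<beta>: "\<beta> \<in> \<Omega>"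
  shows "(\<Sum>\<gamma> | \<gamma> \<in> \<Omega> \<and> f \<gamma> = B. step_prob w \<beta> \<gamma>)
    = (\<Sum>g | g \<in> carrier G \<and> f (\<phi> g \<beta>) = B. w g) / (\<Sum>g\<in>carrier G. w g)"
proof -
  let ?A = "{g. g \<in> carrier G \<and> f (\<phi> g \<beta>) = B}" and ?Z = "{\<gamma>. \<gamma> \<in> \<Omega> \<and> f \<gamma> = B}"
  have "(\<Sum>\<gamma>\<in>?Z. \<Sum>g | g \<in> carrier G \<and> \<phi> g \<beta> = \<gamma>. w g) = (\<Sum>\<gamma>\<in>?Z. \<Sum>g | g \<in> ?A \<and> \<phi> g \<beta> = \<gamma>. w g)"
    by (intro sum.cong refl) auto
  also have "\<dots> = sum w ?A"
    using fin \<beta> act_closed by (intro sum.group) auto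
  finally show ?thesis by (simp add: step_prob_def flip: sum_divide_distrib)
qed

lemma sum_stabilizer_coset:
  assumes y: "y \<in> carrier G" and \<alpha>: "\<alpha> \<in> \<Omega>"
  shows "(\<Sum>k\<in>stabilizer G \<phi> \<alpha>. w (y \<otimes> k)) / (\<Sum>g\<in>carrier G. w g)
    = step_prob w (\<phi> (inv y) \<alpha>) \<alpha>"
  \<comment> \<open>For the walk at \<open>inv y\<close>, the fibre over \<alpha> is the stabiliser,
    and the increment leading to k is \<open>y \<otimes> k\<close>.\<close>
  using sum_random_walk_fibre[of "inv y" \<alpha> w \<alpha>] assms
  by (simp add: stabilizer_def random_walk_def flip: sum_divide_distrib)

text \<open>With \<open>T = {g. \<beta>g \<in> B}\<close>, the probabilities of a step into \<open>B\<close> from \<open>\<beta>\<close> and from \<open>\<beta>h\<close> are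
  \<open>w(T)\<close> and \<open>w(h\<^sup>-\<^sup>1T)\<close> up to normalisation. As \<open>T\<close> is a union of left cosets \<open>gH\<close> and
  \<open>w(gH)\<close> is the probability of a step from \<open>\<alpha>g\<^sup>-\<^sup>1\<close> to \<open>\<alpha>\<close>, they agree coset by coset.\<close>

lemma step_prob_lumpable:
  assumes fin: "finite (carrier G)" "finite \<Omega>" and w: "weight_function G w"
    and \<alpha>: "\<alpha> \<in> \<Omega>" and H: "H = stabilizer G \<phi> \<alpha>"
    and const: "\<And>\<beta> h. \<beta> \<in> \<Omega> \<Longrightarrow> h \<in> H \<Longrightarrow> step_prob w (\<phi> h \<beta>) \<alpha> = step_prob w \<beta> \<alpha>"
    and \<beta>: "\<beta> \<in> \<Omega>" and h: "h \<in> H"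
  defines "f \<equiv> orbit (G\<lparr>carrier := H\<rparr>) \<phi>"
  shows "(\<Sum>\<gamma> | \<gamma> \<in> \<Omega> \<and> f \<gamma> = B. step_prob w (\<phi> h \<beta>) \<gamma>)
    = (\<Sum>\<gamma> | \<gamma> \<in> \<Omega> \<and> f \<gamma> = B. step_prob w \<beta> \<gamma>)"
proof -
  let ?T = "{g. g \<in> carrier G \<and> f (\<phi> g \<beta>) = B}"
  have sub: "subgroup H G" using subgroup_stabilizer[OF \<alpha>] H by simp
  interpret H: subgroup H G by (rule sub)
  have hG: "h \<in> carrier G" using h by simp
  have W: "(\<Sum>g\<in>carrier G. w g) > 0" using w by (simp add: weight_function_def)
  have "{g. g \<in> carrier G \<and> f (\<phi> g (\<phi> h \<beta>)) = B}
      = {g. g \<in> carrier G \<and> f (\<phi> (h \<otimes> g) \<beta>) = B}"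
    using hG \<beta> by (auto simp: act_mult)
  then have "(\<Sum>g | g \<in> carrier G \<and> f (\<phi> g (\<phi> h \<beta>)) = B. w g) = (\<Sum>g\<in>?T. w (inv h \<otimes> g))"
    using sum_left_translate[OF hG, of w "\<lambda>g. f (\<phi> g \<beta>) = B"] by simp
  also have "\<dots> = sum w ?T"
  proof (rule sum_left_translate_eq[OF fin(1) sub])
    \<comment> \<open>Right multiplication by k moves \<beta>g within its H-orbit, which
      \<open>f\<close> does not see.\<close>
    show "g \<otimes> k \<in> ?T" if "g \<in> ?T" "k \<in> H" for g k
      using that \<beta> orbit_subgroup_act[OF sub] by (simp add: act_mult act_closed f_def)
    fix g assume "g \<in> ?T"
    then have g: "g \<in> carrier G" by simp
    have "\<phi> (inv (inv h \<otimes> g)) \<alpha> = \<phi> h (\<phi> (inv g) \<alpha>)"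
      using g hG \<alpha> by (simp add: inv_mult_group act_mult)
    then have "step_prob w (\<phi> (inv (inv h \<otimes> g)) \<alpha>) \<alpha> = step_prob w (\<phi> (inv g) \<alpha>) \<alpha>"
      using const[OF _ h] act_closed g \<alpha> by simp
    then have "(\<Sum>k\<in>H. w (inv h \<otimes> g \<otimes> k)) / (\<Sum>g\<in>carrier G. w g)
        = (\<Sum>k\<in>H. w (g \<otimes> k)) / (\<Sum>g\<in>carrier G. w g)"
      using sum_stabilizer_coset[OF _ \<alpha>, of g w] sum_stabilizer_coset[OF _ \<alpha>, of "inv h \<otimes> g" w]
        g hG by (simp add: H[symmetric])
    then show "(\<Sum>k\<in>H. w (inv h \<otimes> g \<otimes> k)) = (\<Sum>k\<in>H. w (g \<otimes> k))"
      using W by simp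
  qed (use hG in auto)
  finally show ?thesis
    using hG \<beta> by (simp add: sum_step_prob[OF fin] act_closed)
qed

end

section \<open>Lumping the walk to \<Omega> and then to the H-orbits\<close>

theorem corollary1p3:
  fixes G :: "('g, 'b) monoid_scheme" and w :: "'g \<Rightarrow> real"
    and \<Omega> :: "'o set" and \<phi> :: "'g \<Rightarrow> 'o \<Rightarrow> 'o" and \<alpha> :: 'o and H :: "'g set"
  assumes "finite (carrier G)"
    and "weight_function G w"
    and "transitive_right_action G \<Omega> \<phi>"
    and "\<alpha> \<in> \<Omega>"
    and "H = stabilizer G \<phi> \<alpha>"
  shows
    "(\<exists>Q. induces_chain (carrier G) (random_walk G w) (\<lambda>x. \<phi> x \<alpha>) \<Omega> Q) \<and>
     (\<forall>Q. induces_chain (carrier G) (random_walk G w) (\<lambda>x. \<phi> x \<alpha>) \<Omega> Q \<longrightarrow>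
        ((\<exists>R. induces_chain \<Omega> Q (orbit (G\<lparr>carrier := H\<rparr>) \<phi>)
                (orbits (G\<lparr>carrier := H\<rparr>) \<Omega> \<phi>) R) \<longleftrightarrow>
         (\<forall>\<beta> \<in> \<Omega>. \<forall>\<gamma> \<in> \<Omega>.
            orbit (G\<lparr>carrier := H\<rparr>) \<phi> \<beta> = orbit (G\<lparr>carrier := H\<rparr>) \<phi> \<gamma> \<longrightarrow>
            Q \<beta> \<alpha> = Q \<gamma> \<alpha>)))"
proof (intro conjI allI impI)
  interpret transitive_right_action G \<Omega> \<phi> by (rule assms(3))
  note fin = assms(1) and w = assms(2) and \<alpha> = assms(4) and H = assms(5)
  let ?P = "random_walk G w" and ?f = "orbit (G\<lparr>carrier := H\<rparr>) \<phi>"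
  have img: "(\<lambda>x. \<phi> x \<alpha>) ` carrier G = \<Omega>"
    using act_closed[OF _ \<alpha>] transitive[OF \<alpha>] by blast
  then have fin\<Omega>: "finite \<Omega>" using fin by (metis finite_imageI)
  note walk = random_walk_exists[OF fin w]
  show "\<exists>Q. induces_chain (carrier G) ?P (\<lambda>x. \<phi> x \<alpha>) \<Omega> Q"
    by (subst lumpable_iff[OF fin stochastic_on_random_walk[OF fin w] img walk])
      (auto simp: sum_random_walk_fibre[OF _ \<alpha>])
  fix Q assume Q: "induces_chain (carrier G) ?P (\<lambda>x. \<phi> x \<alpha>) \<Omega> Q"
  \<comment> \<open>\<open>Q\<close> is an arbitrary matrix induced by the walk; a walk started at
    some x with \<alpha>x = \<beta> forces its row at \<beta>.\<close>
  have Q_eq: "Q \<beta> \<gamma> = step_prob w \<beta> \<gamma>" if "\<beta> \<in> \<Omega>" "\<gamma> \<in> \<Omega>" for \<beta> \<gamma>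
  proof -
    obtain x where x: "x \<in> carrier G" "\<phi> x \<alpha> = \<beta>" using transitive[OF \<alpha> \<open>\<beta> \<in> \<Omega>\<close>] by blast
    obtain M :: "(nat \<Rightarrow> 'g) measure" and X where "markov_chain M (carrier G) ?P X"
      "\<P>(\<omega> in M. X 0 \<omega> = x) = 1"
      using walk[OF x(1)] by blast
    from induces_chain_imp_lump[OF Q fin this x(1) \<open>\<gamma> \<in> \<Omega>\<close>] show ?thesis
      using x sum_random_walk_fibre[OF x(1) \<alpha>] by simp
  qed
  \<comment> \<open>The image of a walk started at x is a chain from \<beta>, but its sample points
    are sequences in the type of G; passing to path space gives the sample type that
    \<open>lumpable_iff\<close> asks for.\<close>
  have ex: "\<exists>(M :: (nat \<Rightarrow> 'o) measure) X. markov_chain M \<Omega> Q X \<and> \<P>(\<omega> in M. X 0 \<omega> = \<beta>) = 1"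
    if \<beta>: "\<beta> \<in> \<Omega>" for \<beta>
  proof -
    obtain x where x: "x \<in> carrier G" "\<phi> x \<alpha> = \<beta>" using transitive[OF \<alpha> \<beta>] by blast
    obtain M :: "(nat \<Rightarrow> 'g) measure" and X where mc: "markov_chain M (carrier G) ?P X"
      and start: "\<P>(\<omega> in M. X 0 \<omega> = x) = 1"
      using walk[OF x(1)] by blast
    interpret M: prob_space M by (rule markov_chainD(1)[OF mc])
    note [measurable] = markov_chainD(5)[OF mc]
    have "AE \<omega> in M. X 0 \<omega> = x"
      using start by (subst (asm) M.prob_Collect_eq_1) auto
    then have "\<P>(\<omega> in M. \<phi> (X 0 \<omega>) \<alpha> = \<beta>) = 1"
      using x(2) by (subst M.prob_Collect_eq_1) auto
    moreover have "markov_chain M \<Omega> Q (\<lambda>n \<omega>. \<phi> (X n \<omega>) \<alpha>)"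
      using Q mc by (simp add: induces_chain_def)
    from markov_chain_path_space[OF this, of \<beta>]
    obtain M' :: "(nat \<Rightarrow> 'o) measure" where "markov_chain M' \<Omega> Q (\<lambda>n \<omega>. \<omega> n)"
      "\<P>(\<omega> in M'. \<omega> 0 = \<beta>) = \<P>(\<omega> in M. \<phi> (X 0 \<omega>) \<alpha> = \<beta>)" by blast
    ultimately show ?thesis by (intro exI[of _ M'] exI[of _ "\<lambda>n \<omega>. \<omega> n"]) simp
  qed
  have sub: "subgroup H G" using subgroup_stabilizer[OF \<alpha>] H by simp
  \<comment> \<open>H fixes \<alpha>, so the step probability into this orbit is the single entry
    \<open>Q \<beta> \<alpha>\<close>. Lumpability at this one orbit is therefore the condition of
    the theorem.\<close>
  have \<alpha>_fixed: "{\<gamma>. \<gamma> \<in> \<Omega> \<and> ?f \<gamma> = ?f \<alpha>} = {\<alpha>}"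
  proof -
    have "?f \<alpha> = {\<alpha>}"
      using orbit_self[OF sub \<alpha>] H by (auto simp: orbit_def stabilizer_def)
    then show ?thesis using orbit_self[OF sub] \<alpha> by auto
  qed
  have sum_Q: "(\<Sum>\<gamma> | \<gamma> \<in> \<Omega> \<and> ?f \<gamma> = t. Q \<beta> \<gamma>) = (\<Sum>\<gamma> | \<gamma> \<in> \<Omega> \<and> ?f \<gamma> = t. step_prob w \<beta> \<gamma>)"
    if "\<beta> \<in> \<Omega>" for \<beta> t
    using that by (intro sum.cong) (auto simp: Q_eq)
  have "?f ` \<Omega> = orbits (G\<lparr>carrier := H\<rparr>) \<Omega> \<phi>" by (auto simp: orbits_def)
  moreover have "stochastic_on \<Omega> Q" using Q by (simp add: induces_chain_def)
  ultimately have "(\<exists>R. induces_chain \<Omega> Q ?f (orbits (G\<lparr>carrier := H\<rparr>) \<Omega> \<phi>) R) \<longleftrightarrow>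
    (\<forall>\<beta>\<in>\<Omega>. \<forall>\<gamma>\<in>\<Omega>. ?f \<beta> = ?f \<gamma> \<longrightarrow> (\<forall>t\<in>?f ` \<Omega>.
      (\<Sum>z | z \<in> \<Omega> \<and> ?f z = t. Q \<beta> z) = (\<Sum>z | z \<in> \<Omega> \<and> ?f z = t. Q \<gamma> z)))"
    (is "_ \<longleftrightarrow> ?lump")
    using lumpable_iff[OF fin\<Omega> _ refl ex, of ?f] by simp
  also have "?lump \<longleftrightarrow> (\<forall>\<beta>\<in>\<Omega>. \<forall>\<gamma>\<in>\<Omega>. ?f \<beta> = ?f \<gamma> \<longrightarrow> Q \<beta> \<alpha> = Q \<gamma> \<alpha>)" (is "_ \<longleftrightarrow> ?const")
  proof
    assume ?lump
    show ?const
    proof (intro ballI impI)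
      fix \<beta> \<gamma> assume "\<beta> \<in> \<Omega>" "\<gamma> \<in> \<Omega>" "?f \<beta> = ?f \<gamma>"
      with \<open>?lump\<close> \<alpha> have "(\<Sum>z | z \<in> \<Omega> \<and> ?f z = ?f \<alpha>. Q \<beta> z) = (\<Sum>z | z \<in> \<Omega> \<and> ?f z = ?f \<alpha>. Q \<gamma> z)"
        by blast
      then show "Q \<beta> \<alpha> = Q \<gamma> \<alpha>" by (simp add: \<alpha>_fixed)
    qed
  next
    assume const: ?const
    have step_const: "step_prob w (\<phi> h \<beta>) \<alpha> = step_prob w \<beta> \<alpha>" if "\<beta> \<in> \<Omega>" "h \<in> H" for \<beta> h
      using const orbit_subgroup_act[OF sub that(2,1)] that \<alpha> act_closed
        subgroup.mem_carrier[OF sub] by (metis Q_eq)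
    show ?lump
    proof (intro ballI impI)
      fix \<beta> \<gamma> t assume \<beta>: "\<beta> \<in> \<Omega>" and \<gamma>: "\<gamma> \<in> \<Omega>" and "?f \<beta> = ?f \<gamma>"
      then obtain h where h: "h \<in> H" "\<gamma> = \<phi> h \<beta>" using orbit_subgroup_eqD[OF sub] by metis
      show "(\<Sum>z | z \<in> \<Omega> \<and> ?f z = t. Q \<beta> z) = (\<Sum>z | z \<in> \<Omega> \<and> ?f z = t. Q \<gamma> z)"
        using step_prob_lumpable[OF fin fin\<Omega> w \<alpha> H step_const \<beta> h(1), of t] h(2) \<beta> \<gamma>
        by (simp add: sum_Q)
    qed
  qed
  finally show "(\<exists>R. induces_chain \<Omega> Q ?f (orbits (G\<lparr>carrier := H\<rparr>) \<Omega> \<phi>) R) \<longleftrightarrow> ?const" .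
qed

end
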